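(* Let $\rho_{AB}$ be a two-qubit state with Bloch parameters $(\boldsymbol a,\boldsymbol b,T)$, $\boldsymbol b\neq 0$, and $\boldsymbol n_B=\boldsymbol b/|\boldsymbol b|$. For unit $\boldsymbol m\in\mathbb R^3$ with $1+\boldsymbol a\cdot\boldsymbol m>0$ let $$\boldsymbol r(\boldsymbol m)=\frac{\boldsymbol b+T^T\boldsymbol m}{1+\boldsymbol a\cdot\boldsymbol m},\qquad r_\parallel(\boldsymbol m)=\boldsymbol r(\boldsymbol m)\cdot\boldsymbol n_B,\qquad r_\perp(\boldsymbol m)=|\boldsymbol r(\boldsymbol m)\times\boldsymbol n_B| .$$ Then the maximal steered KD nonclassicality of $\rho_{AB}$ is $$\mathcal R_{KD}(\rho_{AB})=\max_{|\boldsymbol m|=1}\ \max_{s=\pm1}\ \frac14\Big[\sqrt{(1+s\,r_\parallel(s\boldsymbol m))^2+r_\perp^2(s\boldsymbol m)}+\sqrt{(1-s\,r_\parallel(s\boldsymbol m))^2+r_\perp^2(s\boldsymbol m)}\Big]-\frac12 ,$$ where only directions $s\boldsymbol m$ with $1+\boldsymbol a\cdot s\boldsymbol m>0$ (outcomes of nonzero probability) are considered.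
   Context: A two-qubit state is written $\rho_{AB}=\tfrac14\big[\mathbb I\otimes\mathbb I+\boldsymbol a\cdot\boldsymbol\sigma\otimes\mathbb I+\mathbb I\otimes\boldsymbol b\cdot\boldsymbol\sigma+\sum_{i,j=1}^3T_{ij}\,\sigma_i\otimes\sigma_j\big]$, with $\boldsymbol a,\boldsymbol b\in\mathbb R^3$ the local Bloch vectors and $T$ a real $3\times3$ matrix; Bob's reduced state is $\rho_B=\tfrac12(\mathbb I+\boldsymbol b\cdot\boldsymbol\sigma)$. KD nonclassicality: the first (reference) basis is the eigenbasis of $\boldsymbol n_B\cdot\boldsymbol\sigma$, with projectors $\Pi_0,\Pi_1$. For an orthonormal qubit basis $\{|b_k\rangle\}_{k=0,1}$ and a qubit state $\rho$, put $Q_{ik}(\rho)=\mathrm{Tr}(|b_k\rangle\langle b_k|\,\Pi_i\,\rho)$, and define $\mathcal N_{KD}(\rho)=\max_{\{|b_k\rangle\}}\tfrac12\big(\sum_{i,k}|Q_{ik}(\rho)|-1\big)$, the maximum over all orthonormal qubit bases, with the reference direction $\boldsymbol n_B$ fixed. Steering: for a POVM $\{M_a\}$ on Alice's qubit, outcome $a$ has probability $p(a)=\mathrm{Tr}[(M_a\otimes\mathbb I)\rho_{AB}]$ and, if $p(a)>0$, Bob's conditional state is $\rho_{B|a}=\mathrm{Tr}_A[(M_a\otimes\mathbb I)\rho_{AB}]/p(a)$. The maximal steered KD nonclassicality is $\mathcal R_{KD}(\rho_{AB})=\max_{\{M_a\},a}\mathcal N_{KD}(\rho_{B|a})$, over all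 POVMs on Alice's qubit and all outcomes $a$ of nonzero probability. *)

theory Defs
  imports "HOL-Analysis.Analysis"
begin

definition is_maximum :: "real set \<Rightarrow> real \<Rightarrow> bool" where
  "is_maximum S v \<longleftrightarrow> v \<in> S \<and> (\<forall>w\<in>S. w \<le> v)"

text \<open>The constant \<open>Max\<close> of the library is only meaningful on finite sets. The following is the
  greatest element of an arbitrary set of reals, and is unspecified if there is none.\<close>

definition maximum :: "real set \<Rightarrow> real" where
  "maximum S = (GREATEST v. v \<in> S)"

definition cdot :: "complex^'n \<Rightarrow> complex^'n \<Rightarrow> complex" where
  "cdot v w = (\<Sum>i\<in>UNIV. cnj (v $ i) * w $ i)"

definition hermitian :: "complex^'n^'n \<Rightarrow> bool" where
  "hermitian A \<longleftrightarrow> (\<forall>i j. A $ i $ j = cnj (A $ j $ i))"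

definition pos_semidef :: "complex^'n^'n \<Rightarrow> bool" where
  "pos_semidef A \<longleftrightarrow> hermitian A \<and> (\<forall>v. 0 \<le> Re (cdot v (A *v v)))"

definition density_operator :: "complex^'n^'n \<Rightarrow> bool" where
  "density_operator A \<longleftrightarrow> pos_semidef A \<and> trace A = 1"

definition ket_bra :: "complex^'n \<Rightarrow> complex^'n^'n" where
  "ket_bra v = (\<chi> i j. v $ i * cnj (v $ j))"

definition kron :: "complex^2^2 \<Rightarrow> complex^2^2 \<Rightarrow> complex^(2 \<times> 2)^(2 \<times> 2)" where
  "kron A B = (\<chi> i j. A $ fst i $ fst j * B $ snd i $ snd j)"

definition ptrace_A :: "complex^(2 \<times> 2)^(2 \<times> 2) \<Rightarrow> complex^2^2" where
  "ptrace_A X = (\<chi> i j. \<Sum>k\<in>UNIV. X $ (k, i) $ (k, j))"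

definition pauli :: "3 \<Rightarrow> complex^2^2" where
  "pauli i =
    (if i = 1 then vector [vector [0, 1], vector [1, 0]]
     else if i = 2 then vector [vector [0, - \<i>], vector [\<i>, 0]]
     else vector [vector [1, 0], vector [0, - 1]])"

definition pauli_dot :: "real^3 \<Rightarrow> complex^2^2" where
  "pauli_dot v = (\<Sum>i\<in>UNIV. (v $ i) *\<^sub>R pauli i)"

definition bloch_form :: "real^3 \<Rightarrow> real^3 \<Rightarrow> real^3^3 \<Rightarrow> complex^(2 \<times> 2)^(2 \<times> 2)" where
  "bloch_form a b T = (1/4) *\<^sub>R
     (kron (mat 1) (mat 1) + kron (pauli_dot a) (mat 1) + kron (mat 1) (pauli_dot b)
      + (\<Sum>i\<in>UNIV. \<Sum>j\<in>UNIV. (T $ i $ j) *\<^sub>R kron (pauli i) (pauli j)))"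

text \<open>Two orthonormal vectors of \<open>complex^2\<close> automatically span the space.\<close>

definition orthonormal_basis :: "(2 \<Rightarrow> complex^2) \<Rightarrow> bool" where
  "orthonormal_basis e \<longleftrightarrow> (\<forall>i j. cdot (e i) (e j) = (if i = j then 1 else 0))"

definition eigenbasis :: "complex^2^2 \<Rightarrow> (2 \<Rightarrow> complex^2) \<Rightarrow> bool" where
  "eigenbasis A e \<longleftrightarrow> orthonormal_basis e \<and> (\<forall>i. \<exists>l. A *v e i = l *s e i)"

text \<open>Kirkwood--Dirac quasiprobabilities of \<open>\<rho>\<close> for the reference basis \<open>e\<close> and the second
  basis \<open>f\<close>.\<close>

definition kd_quasi ::
  "(2 \<Rightarrow> complex^2) \<Rightarrow> (2 \<Rightarrow> complex^2) \<Rightarrow> complex^2^2 \<Rightarrow> 2 \<Rightarrow> 2 \<Rightarrow> complex" where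
  "kd_quasi e f \<rho> i k = trace (ket_bra (f k) ** ket_bra (e i) ** \<rho>)"

definition N_KD :: "(2 \<Rightarrow> complex^2) \<Rightarrow> complex^2^2 \<Rightarrow> real" where
  "N_KD e \<rho> = maximum
     {(1/2) * ((\<Sum>i\<in>UNIV. \<Sum>k\<in>UNIV. cmod (kd_quasi e f \<rho> i k)) - 1) | f. orthonormal_basis f}"

definition povm :: "nat set \<Rightarrow> (nat \<Rightarrow> complex^2^2) \<Rightarrow> bool" where
  "povm I M \<longleftrightarrow> finite I \<and> (\<forall>x\<in>I. pos_semidef (M x)) \<and> (\<Sum>x\<in>I. M x) = mat 1"

text \<open>The trace below is real for positive semidefinite \<open>E\<close> and \<open>\<rho>\<close>.\<close>

definition outcome_prob :: "complex^2^2 \<Rightarrow> complex^(2 \<times> 2)^(2 \<times> 2) \<Rightarrow> real" where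
  "outcome_prob E \<rho> = Re (trace (kron E (mat 1) ** \<rho>))"

definition steered_state :: "complex^2^2 \<Rightarrow> complex^(2 \<times> 2)^(2 \<times> 2) \<Rightarrow> complex^2^2" where
  "steered_state E \<rho> = (1 / outcome_prob E \<rho>) *\<^sub>R ptrace_A (kron E (mat 1) ** \<rho>)"

definition steered_KD_values ::
  "(2 \<Rightarrow> complex^2) \<Rightarrow> complex^(2 \<times> 2)^(2 \<times> 2) \<Rightarrow> real set" where
  "steered_KD_values e \<rho> =
     {N_KD e (steered_state (M x) \<rho>) | I M x. povm I M \<and> x \<in> I \<and> outcome_prob (M x) \<rho> > 0}"

definition R_KD :: "(2 \<Rightarrow> complex^2) \<Rightarrow> complex^(2 \<times> 2)^(2 \<times> 2) \<Rightarrow> real" where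
  "R_KD e \<rho> = maximum (steered_KD_values e \<rho>)"

definition steered_bloch :: "real^3 \<Rightarrow> real^3 \<Rightarrow> real^3^3 \<Rightarrow> real^3 \<Rightarrow> real^3" where
  "steered_bloch a b T m = (1 / (1 + a \<bullet> m)) *\<^sub>R (b + transpose T *v m)"

definition r_par :: "real^3 \<Rightarrow> real^3 \<Rightarrow> real^3^3 \<Rightarrow> real^3 \<Rightarrow> real^3 \<Rightarrow> real" where
  "r_par a b T n m = steered_bloch a b T m \<bullet> n"

definition r_perp :: "real^3 \<Rightarrow> real^3 \<Rightarrow> real^3^3 \<Rightarrow> real^3 \<Rightarrow> real^3 \<Rightarrow> real" where
  "r_perp a b T n m = norm (cross3 (steered_bloch a b T m) n)"

end

theory Submission
  imports Defs
begin

text \<open>For a Hermitian qubit operator \<open>\<rho>\<close> and a reference basis \<open>e\<close>, Cauchy--Schwarz and Parseval bound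
  each row \<open>\<Sum>k. |Q i k|\<close> by \<open>\<parallel>\<rho> e i\<parallel>\<close>, and a suitable basis unbiased to \<open>e\<close> attains both bounds at once.
  If \<open>\<rho>\<close> has Bloch vector \<open>r\<close> and \<open>e\<close> is the eigenbasis of \<open>n \<cdot> \<sigma>\<close>, the two norms are
  \<open>\<parallel>r \<plusminus> n\<parallel> / 2\<close>, so the nonclassicality is \<open>g r = (\<parallel>r + n\<parallel> + \<parallel>r - n\<parallel>) / 4 - 1/2\<close>. An effect
  \<open>c I + w \<cdot> \<sigma>\<close> steers Bob to \<open>r = (c b + T\<^sup>T w) / (c + a \<cdot> w)\<close>. It is a positive combination of
  the projectors along \<open>\<plusminus> w\<close>, and \<open>g\<close> is convex, so projective measurements suffice. The maximum over
  their directions is attained: by compactness if \<open>\<parallel>a\<parallel> < 1\<close>, and because positivity forces a product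
  state, hence a constant \<open>r = b\<close>, if \<open>\<parallel>a\<parallel> = 1\<close>.\<close>

lemma maximum_eq: "is_maximum S v \<Longrightarrow> maximum S = v"
  unfolding is_maximum_def maximum_def by (intro Greatest_equality) auto

subsection \<open>Orthonormal bases of \<open>\<complex>\<^sup>2\<close>\<close>

lemma cdot_add_left: "cdot (u + v) w = cdot u w + cdot v w"
  and cdot_add_right: "cdot u (v + w) = cdot u v + cdot u w"
  by (simp_all add: cdot_def algebra_simps sum.distrib)

lemma cdot_scale_left: "cdot (c *s v) w = cnj c * cdot v w"
  and cdot_scale_right: "cdot v (c *s w) = c * cdot v w"
  by (simp_all add: cdot_def sum_distrib_left algebra_simps)

lemma cdot_commute: "cdot w v = cnj (cdot v w)"
  by (simp add: cdot_def mult.commute)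

lemma cdot_self: "cdot v v = of_real ((norm v)\<^sup>2)"
proof -
  have "(norm v)\<^sup>2 = (\<Sum>i\<in>UNIV. (cmod (v $ i))\<^sup>2)"
    by (simp add: norm_vec_def L2_set_def sum_nonneg)
  then show ?thesis
    by (simp add: cdot_def complex_norm_square mult.commute del: of_real_power)
qed

lemma cdot_hermitian: "hermitian A \<Longrightarrow> cdot v (A *v w) = cdot (A *v v) w"
proof -
  assume A: "hermitian A"
  have "cdot v (A *v w) = (\<Sum>i\<in>UNIV. \<Sum>j\<in>UNIV. cnj (v $ i) * A $ i $ j * w $ j)"
    by (simp add: cdot_def matrix_vector_mult_def sum_distrib_left mult.assoc)
  also have "\<dots> = (\<Sum>j\<in>UNIV. \<Sum>i\<in>UNIV. cnj (v $ i) * A $ i $ j * w $ j)"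
    by (rule sum.swap)
  also have "\<dots> = (\<Sum>j\<in>UNIV. \<Sum>i\<in>UNIV. cnj (v $ i) * cnj (A $ j $ i) * w $ j)"
  proof (intro sum.cong refl)
    show "cnj (v $ i) * A $ i $ j * w $ j = cnj (v $ i) * cnj (A $ j $ i) * w $ j" for i j
      using A unfolding hermitian_def by metis
  qed
  also have "\<dots> = cdot (A *v v) w"
    by (simp add: cdot_def matrix_vector_mult_def sum_distrib_left sum_distrib_right mult_ac)
  finally show ?thesis .
qed

lemma cmod_cdot_hermitian: "hermitian A \<Longrightarrow> cmod (cdot v (A *v w)) = cmod (cdot w (A *v v))"
  by (metis cdot_hermitian cdot_commute complex_mod_cnj)

lemma ket_bra_mult_vec: "ket_bra u *v v = cdot u v *s u"
  by (simp add: vec_eq_iff ket_bra_def matrix_vector_mult_def cdot_def sum_distrib_left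
      sum_distrib_right mult_ac)

text \<open>Orthonormality says that the matrix \<open>U\<close> with columns \<open>f k\<close> has
  its adjoint \<open>V\<close> as left inverse. For square matrices this is also a right
  inverse.\<close>

lemma orthonormal_basis_complete:
  assumes "orthonormal_basis f"
  shows "(\<Sum>k\<in>UNIV. ket_bra (f k)) = mat 1"
proof -
  define U where "U = (\<chi> i k. f k $ i)"
  define V where "V = (\<chi> k i. cnj (f k $ i))"
  have "V ** U = mat 1"
    using assms unfolding orthonormal_basis_def cdot_def
    by (simp add: U_def V_def matrix_matrix_mult_def vec_eq_iff mat_def)
  then have "U ** V = mat 1"
    using matrix_left_right_inverse by blast
  moreover have "U ** V = (\<Sum>k\<in>UNIV. ket_bra (f k))"
    by (simp add: U_def V_def matrix_matrix_mult_def vec_eq_iff ket_bra_def)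
  ultimately show ?thesis by simp
qed

lemma orthonormal_basis_expansion:
  assumes "orthonormal_basis f"
  shows "(\<Sum>k\<in>UNIV. cdot (f k) v *s f k) = v"
proof -
  have "(\<Sum>k\<in>UNIV. cdot (f k) v *s f k) = (\<Sum>k\<in>UNIV. ket_bra (f k)) *v v"
    by (simp add: ket_bra_mult_vec sum_2 matrix_vector_mult_add_rdistrib)
  then show ?thesis
    by (simp add: orthonormal_basis_complete[OF assms])
qed

lemma parseval:
  assumes "orthonormal_basis f"
  shows "(\<Sum>k\<in>UNIV. (cmod (cdot (f k) v))\<^sup>2) = (norm v)\<^sup>2"
proof -
  have "cdot v v = cdot v (\<Sum>k\<in>UNIV. cdot (f k) v *s f k)"
    by (simp add: orthonormal_basis_expansion[OF assms])
  also have "\<dots> = (\<Sum>k\<in>UNIV. cdot (f k) v * cnj (cdot (f k) v))"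
    by (simp add: sum_2 cdot_add_right cdot_scale_right flip: cdot_commute)
  also have "\<dots> = of_real (\<Sum>k\<in>UNIV. (cmod (cdot (f k) v))\<^sup>2)"
    by (simp add: complex_norm_square del: of_real_power)
  finally show ?thesis
    unfolding cdot_self by (metis of_real_eq_iff)
qed

subsection \<open>Kirkwood--Dirac nonclassicality of a qubit\<close>

lemma kd_quasi_eq: "kd_quasi e f \<rho> i k = cdot (f k) (e i) * cdot (e i) (\<rho> *v f k)"
  by (simp add: kd_quasi_def trace_def matrix_matrix_mult_def ket_bra_def cdot_def
      matrix_vector_mult_def sum_2 algebra_simps)

text \<open>Up to modulus, Hermiticity makes the second factor in \<open>kd_quasi_eq\<close> a
  coefficient of \<open>\<rho> *v e i\<close> in the basis \<open>f\<close>, so Cauchy-Schwarz ends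
  in norms that no longer see \<open>f\<close>.\<close>

lemma kd_row_le:
  assumes f: "orthonormal_basis f" and e: "orthonormal_basis e" and h: "hermitian \<rho>"
  shows "(\<Sum>k\<in>UNIV. cmod (kd_quasi e f \<rho> i k)) \<le> norm (\<rho> *v e i)"
proof -
  have n: "norm (e i) = 1"
    using e cdot_self[of "e i"] unfolding orthonormal_basis_def
    by (metis norm_ge_zero of_real_1 of_real_eq_iff one_power2 power2_eq_iff_nonneg zero_le_one)
  have "(\<Sum>k\<in>UNIV. cmod (kd_quasi e f \<rho> i k))
      = (\<Sum>k\<in>UNIV. cmod (cdot (f k) (e i)) * cmod (cdot (f k) (\<rho> *v e i)))"
    by (simp add: kd_quasi_eq norm_mult cmod_cdot_hermitian[OF h, of "e i"])
  also have "\<dots> \<le> L2_set (\<lambda>k. cmod (cdot (f k) (e i))) UNIV * L2_set (\<lambda>k. cmod (cdot (f k) (\<rho> *v e i))) UNIV"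
    using L2_set_mult_ineq[of "\<lambda>k. cmod (cdot (f k) (e i))" "\<lambda>k. cmod (cdot (f k) (\<rho> *v e i))" UNIV]
    by simp
  also have "\<dots> = norm (\<rho> *v e i)"
    by (simp add: L2_set_def parseval[OF f] n)
  finally show ?thesis .
qed

text \<open>Equality holds for a basis that is unbiased with respect to \<open>e\<close>, with the relative
  phase \<open>z\<close> in quadrature with the off-diagonal element of \<open>\<rho>\<close>.\<close>

lemma kd_optimal_basis:
  assumes e: "orthonormal_basis e" and h: "hermitian \<rho>"
  obtains f where "orthonormal_basis f"
    "\<And>i. (\<Sum>k\<in>UNIV. cmod (kd_quasi e f \<rho> i k)) = norm (\<rho> *v e i)"
proof -
  define w where "w = cdot (e 1) (\<rho> *v e 2)"
  \<comment> \<open>The product of \<open>w\<close> with \<open>cnj (sgn w)\<close> is the real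
    number \<open>cmod w\<close>, so a further factor \<open>\<i>\<close> makes it imaginary. Any
    phase serves when \<open>w = 0\<close>.\<close>
  obtain z where z: "cnj z * z = 1" and zw: "Re (w * z) = 0"
  proof (cases "w = 0")
    case False
    show thesis
    proof
      show "cnj (\<i> * cnj (sgn w)) * (\<i> * cnj (sgn w)) = 1"
        using False complex_norm_square[of "sgn w"] by (simp add: norm_sgn mult_ac)
      show "Re (w * (\<i> * cnj (sgn w))) = 0"
        by (simp add: sgn_eq mult_ac)
    qed
  qed (use that[of 1] in simp)
  define s where "s k = (if k = 1 then z else - z)" for k :: 2
  define f where "f k = complex_of_real (1 / sqrt 2) *s (e 1 + s k *s e 2)" for k :: 2
  have ee: "cdot (e 1) (e 1) = 1" "cdot (e 1) (e 2) = 0" "cdot (e 2) (e 1) = 0" "cdot (e 2) (e 2) = 1"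
    using e by (auto simp: orthonormal_basis_def)
  have sq2: "complex_of_real (sqrt 2) * complex_of_real (sqrt 2) = 2"
    by (metis of_real_mult of_real_numeral real_sqrt_mult_self abs_numeral)
  have cs: "cnj (s k) * s k = 1" for k
    using z by (simp add: s_def)
  have "cdot (f k) (f l) = (if k = l then 1 else 0)" for k l
    using z exhaust_2[of k] exhaust_2[of l]
    by (auto simp: f_def s_def cdot_scale_left cdot_scale_right cdot_add_left cdot_add_right
        ee sq2 mult.commute)
  then have of: "orthonormal_basis f"
    by (simp add: orthonormal_basis_def)
  have fe: "cmod (cdot (f k) (e i)) = 1 / sqrt 2" for i k
  proof -
    have "cmod (s k) = 1"
      using arg_cong[OF cs[of k], of cmod] by (simp add: norm_mult abs_square_eq_1 flip: power2_eq_square)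
    then show ?thesis
      using exhaust_2[of i]
      by (auto simp: f_def cdot_scale_left cdot_add_left ee norm_mult norm_divide)
  qed
  have eqf: "cmod (cdot (f k) (\<rho> *v e i)) = cmod (cdot (f 1) (\<rho> *v e i))" for i k
  proof -
    \<comment> \<open>The coefficients of \<open>\<rho> *v e i\<close> in \<open>f\<close> are
      \<open>x \<plusminus> y\<close> up to \<open>1 / sqrt 2\<close>. Their moduli agree because
      \<open>x * cnj y\<close> is a real diagonal element of \<open>\<rho>\<close> times the
      imaginary number \<open>w * z\<close>.\<close>
    define x y where "x = cdot (e 1) (\<rho> *v e i)" and "y = cnj z * cdot (e 2) (\<rho> *v e i)"
    have f: "cdot (f k) (\<rho> *v e i) = of_real (1 / sqrt 2) * (x + (if k = 1 then y else - y))" for k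
      by (simp add: f_def s_def x_def y_def cdot_scale_left cdot_add_left add_divide_distrib
          diff_divide_distrib)
    have diag: "Im (cdot (e j) (\<rho> *v e j)) = 0" for j
      using cdot_commute[of "e j" "\<rho> *v e j"] cdot_hermitian[OF h, of "e j" "e j"]
      by (simp add: complex_eq_iff)
    have "cdot (e 2) (\<rho> *v e 1) = cnj w"
      by (metis w_def cdot_commute cdot_hermitian[OF h])
    then have "Re (x * cnj y) = 0"
      using exhaust_2[of i] zw diag[of i]
      by (auto simp: x_def y_def w_def algebra_simps)
    then have "cmod (x + y) = cmod (x - y)"
      by (simp add: cmod_def power2_eq_square algebra_simps)
    then show ?thesis
      by (simp add: f norm_divide)
  qed
  have c: "(cmod (cdot (f k) (\<rho> *v e i)))\<^sup>2 = (norm (\<rho> *v e i))\<^sup>2 / 2" for i k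
  proof -
    have "cmod (cdot (f 2) (\<rho> *v e i)) = cmod (cdot (f 1) (\<rho> *v e i))"
      by (rule eqf)
    then have "(norm (\<rho> *v e i))\<^sup>2 = 2 * (cmod (cdot (f 1) (\<rho> *v e i)))\<^sup>2"
      unfolding parseval[OF of, of "\<rho> *v e i", symmetric] by (simp add: sum_2)
    then show ?thesis
      by (simp add: eqf[of k])
  qed
  have "(\<Sum>k\<in>UNIV. cmod (kd_quasi e f \<rho> i k)) = norm (\<rho> *v e i)" for i
  proof -
    have d: "cmod (cdot (f k) (\<rho> *v e i)) = norm (\<rho> *v e i) / sqrt 2" for k
      using c[of k i] by (smt (verit) norm_ge_zero real_sqrt_divide real_sqrt_unique)
    have "cmod (kd_quasi e f \<rho> i k) = norm (\<rho> *v e i) / 2" for k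
      by (simp add: kd_quasi_eq norm_mult fe cmod_cdot_hermitian[OF h, of "e i"] d)
    then show ?thesis by (simp add: sum_2 del: eq_divide_eq_numeral1)
  qed
  with of that show thesis by blast
qed

lemma N_KD_eq:
  assumes "orthonormal_basis e" and "hermitian \<rho>"
  shows "N_KD e \<rho> = ((\<Sum>i\<in>UNIV. norm (\<rho> *v e i)) - 1) / 2"
proof -
  obtain f where f: "orthonormal_basis f"
    "\<And>i. (\<Sum>k\<in>UNIV. cmod (kd_quasi e f \<rho> i k)) = norm (\<rho> *v e i)"
    using kd_optimal_basis[OF assms] by blast
  show ?thesis
    unfolding N_KD_def
  proof (rule maximum_eq, unfold is_maximum_def, intro conjI ballI, goal_cases)
    case 1
    show ?case using f by (auto intro!: exI[of _ f])
  next
    case (2 w)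
    then obtain g where g: "orthonormal_basis g"
      "w = 1/2 * ((\<Sum>i\<in>UNIV. \<Sum>k\<in>UNIV. cmod (kd_quasi e g \<rho> i k)) - 1)" by blast
    have "(\<Sum>i\<in>UNIV. \<Sum>k\<in>UNIV. cmod (kd_quasi e g \<rho> i k)) \<le> (\<Sum>i\<in>UNIV. norm (\<rho> *v e i))"
      by (intro sum_mono kd_row_le g assms)
    then show ?case using g by simp
  qed
qed

subsection \<open>Pauli coordinates\<close>

definition qubit_op :: "real \<Rightarrow> real^3 \<Rightarrow> complex^2^2" where
  "qubit_op c w = c *\<^sub>R mat 1 + pauli_dot w"

text \<open>The components are the expectation values of the Pauli matrices in \<open>v\<close>.
  Leaving \<open>v\<close> unnormalised avoids division.\<close>

definition bloch :: "complex^2 \<Rightarrow> real^3" where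
  "bloch v = vector [2 * Re (cnj (v $ 1) * v $ 2), 2 * Im (cnj (v $ 1) * v $ 2),
     (cmod (v $ 1))\<^sup>2 - (cmod (v $ 2))\<^sup>2]"

lemma pauli_simps [simp]:
  "pauli 1 = vector [vector [0, 1], vector [1, 0]]"
  "pauli 2 = vector [vector [0, - \<i>], vector [\<i>, 0]]"
  "pauli 3 = vector [vector [1, 0], vector [0, - 1]]"
  by (simp_all add: pauli_def)

lemma qubit_op_entries:
  "qubit_op c w $ 1 $ 1 = Complex (c + w $ 3) 0"
  "qubit_op c w $ 1 $ 2 = Complex (w $ 1) (- w $ 2)"
  "qubit_op c w $ 2 $ 1 = Complex (w $ 1) (w $ 2)"
  "qubit_op c w $ 2 $ 2 = Complex (c - w $ 3) 0"
  by (simp_all add: qubit_op_def pauli_dot_def sum_3 mat_def complex_eq_iff)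

lemma hermitian_qubit_op: "hermitian (qubit_op c w)"
  by (simp add: hermitian_def forall_2 qubit_op_entries complex_eq_iff)

lemma hermitian_imp_qubit_op:
  assumes "hermitian E"
  shows "\<exists>c w. E = qubit_op c w"
proof -
  have h: "E $ i $ j = cnj (E $ j $ i)" for i j
    using assms unfolding hermitian_def by blast
  have "E = qubit_op ((Re (E $ 1 $ 1) + Re (E $ 2 $ 2)) / 2)
     (vector [Re (E $ 1 $ 2), - Im (E $ 1 $ 2), (Re (E $ 1 $ 1) - Re (E $ 2 $ 2)) / 2])"
    using h[of 1 1] h[of 2 2] h[of 1 2]
    by (simp add: vec_eq_iff forall_2 qubit_op_entries complex_eq_iff field_simps)
  then show ?thesis by blast
qed

lemma scaleR_qubit_op: "r *\<^sub>R qubit_op c w = qubit_op (r * c) (r *\<^sub>R w)"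
  by (simp add: vec_eq_iff forall_2 qubit_op_entries complex_eq_iff algebra_simps)

lemma norm_vec_2_power2:
  "(norm v)\<^sup>2 = (Re (v $ 1))\<^sup>2 + (Im (v $ 1))\<^sup>2 + (Re (v $ 2))\<^sup>2 + (Im (v $ 2))\<^sup>2"
  for v :: "complex^2"
  by (simp add: norm_vec_def L2_set_def sum_2 cmod_power2)

lemma cdot_qubit_op:
  "cdot v (qubit_op c w *v v) = of_real (c * (norm v)\<^sup>2 + w \<bullet> bloch v)"
  unfolding norm_vec_2_power2
  by (simp add: complex_eq_iff cdot_def matrix_vector_mult_def sum_2 sum_3 inner_vec_def
      bloch_def qubit_op_entries cmod_power2 algebra_simps)
    (simp add: power2_eq_square algebra_simps)

lemma norm_bloch: "norm (bloch v) = (norm v)\<^sup>2"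
proof -
  have "(norm (bloch v))\<^sup>2 = ((norm v)\<^sup>2)\<^sup>2"
    unfolding norm_vec_2_power2 power2_norm_eq_inner
    by (simp add: inner_vec_def sum_3 bloch_def cmod_power2) algebra
  then show ?thesis
    by (subst (asm) power2_eq_iff_nonneg) auto
qed

text \<open>Distinct Pauli matrices anticommute, so the square of \<open>qubit_op c w\<close> has
  scalar part \<open>c\<^sup>2 + (norm w)\<^sup>2\<close> and vector part
  \<open>(2 * c) *\<^sub>R w\<close>. The right-hand side is its expectation value.\<close>

lemma norm_qubit_op_mult:
  "(norm (qubit_op c w *v v))\<^sup>2 = (c\<^sup>2 + (norm w)\<^sup>2) * (norm v)\<^sup>2 + 2 * c * (w \<bullet> bloch v)"
  unfolding norm_vec_2_power2 power2_norm_eq_inner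
  by (simp add: matrix_vector_mult_def sum_2 sum_3 inner_vec_def bloch_def qubit_op_entries
      cmod_power2) (simp add: power2_eq_square algebra_simps)

text \<open>The representative is \<open>(1 + m\<^sub>3, m\<^sub>1 + \<i> m\<^sub>2)\<close>, which only vanishes at the south pole.\<close>

lemma bloch_surj_sphere:
  assumes "norm m = 1"
  obtains u where "norm u > 0" "bloch u = (norm u)\<^sup>2 *\<^sub>R m"
proof -
  have m: "(m $ 1)\<^sup>2 + (m $ 2)\<^sup>2 + (m $ 3)\<^sup>2 = 1"
    using assms by (simp add: norm_eq_1 inner_vec_def sum_3 power2_eq_square)
  show thesis
  proof (cases "m $ 3 = - 1")
    case True
    then have "m $ 1 = 0" "m $ 2 = 0"
      using m by (auto simp: add_nonneg_eq_0_iff)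
    let ?u = "vector [0, 1] :: complex^2"
    have nu: "(norm ?u)\<^sup>2 = 1" by (simp add: norm_vec_2_power2)
    show thesis
    proof (rule that)
      show "norm ?u > 0" using nu by (metis norm_eq_zero zero_less_norm_iff norm_zero zero_neq_one zero_power2)
      show "bloch ?u = (norm ?u)\<^sup>2 *\<^sub>R m"
        unfolding nu using True \<open>m $ 1 = 0\<close> \<open>m $ 2 = 0\<close>
        by (simp add: vec_eq_iff forall_3 bloch_def)
    qed
  next
    case False
    let ?u = "vector [of_real (1 + m $ 3), Complex (m $ 1) (m $ 2)] :: complex^2"
    have "(m $ 1)\<^sup>2 + (m $ 2)\<^sup>2 = (1 - m $ 3) * (1 + m $ 3)"
      using m by algebra
    then have nu: "(norm ?u)\<^sup>2 = 2 * (1 + m $ 3)"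
      by (simp add: norm_vec_2_power2 algebra_simps) (simp add: power2_eq_square algebra_simps)
    show thesis
    proof (rule that)
      have "(norm ?u)\<^sup>2 \<noteq> 0" unfolding nu using False by simp
      then show "norm ?u > 0" by auto
      show "bloch ?u = (norm ?u)\<^sup>2 *\<^sub>R m"
        unfolding nu using m
        by (simp add: vec_eq_iff forall_3 bloch_def cmod_power2) algebra
    qed
  qed
qed

text \<open>By \<open>cdot_qubit_op\<close>, the quadratic form at vectors of given norm is smallest
  when \<open>bloch v\<close> points against \<open>w\<close>, a direction supplied by
  \<open>bloch_surj_sphere\<close>. Hence \<open>c - norm w\<close> is the least eigenvalue.\<close>

lemma pos_semidef_qubit_op: "pos_semidef (qubit_op c w) \<longleftrightarrow> norm w \<le> c"
proof
  assume p: "pos_semidef (qubit_op c w)"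
  have "\<exists>m. norm m = 1 \<and> w \<bullet> m = - norm w"
  proof (cases "w = 0")
    case True then show ?thesis using vector_choose_size[of 1] by auto
  next
    case False
    then show ?thesis
      by (intro exI[of _ "- (1 / norm w) *\<^sub>R w"])
        (simp add: power2_norm_eq_inner[symmetric] power2_eq_square)
  qed
  then obtain m where m: "norm m = 1" "w \<bullet> m = - norm w" by blast
  obtain u where u: "norm u > 0" "bloch u = (norm u)\<^sup>2 *\<^sub>R m"
    using bloch_surj_sphere[OF m(1)] .
  have "0 \<le> c * (norm u)\<^sup>2 + w \<bullet> bloch u"
    using p unfolding pos_semidef_def cdot_qubit_op by simp
  also have "\<dots> = (c - norm w) * (norm u)\<^sup>2"
    by (simp add: u m algebra_simps)
  finally show "norm w \<le> c"
    using u by (simp add: zero_le_mult_iff)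
next
  assume "norm w \<le> c"
  have "0 \<le> c * (norm v)\<^sup>2 + w \<bullet> bloch v" for v
  proof -
    have "- (w \<bullet> bloch v) \<le> norm w * (norm v)\<^sup>2"
      using Cauchy_Schwarz_ineq2[of w "bloch v"] by (simp add: norm_bloch)
    also have "\<dots> \<le> c * (norm v)\<^sup>2"
      using \<open>norm w \<le> c\<close> by (intro mult_right_mono) auto
    finally show ?thesis by simp
  qed
  then show "pos_semidef (qubit_op c w)"
    by (simp add: pos_semidef_def hermitian_qubit_op cdot_qubit_op)
qed

subsection \<open>Steering in Bloch coordinates\<close>

lemma sum_UNIV_prod: "(\<Sum>p\<in>UNIV. F p) = (\<Sum>i\<in>UNIV. \<Sum>j\<in>UNIV. F (i, j))"
  for F :: "'a::finite \<times> 'b::finite \<Rightarrow> 'c::comm_monoid_add"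
  by (simp add: sum.cartesian_product flip: UNIV_Times_UNIV)

lemma ptrace_A_kron_mat_1:
  "ptrace_A (kron E (mat 1) ** X) $ i $ j
     = (\<Sum>k\<in>UNIV. \<Sum>l\<in>UNIV. E $ k $ l * X $ (l, i) $ (k, j))"
  using exhaust_2[of i]
  by (auto simp: ptrace_A_def matrix_matrix_mult_def sum_UNIV_prod sum_2 kron_def mat_def)

text \<open>Sorting the terms by Alice's Pauli matrix prepares the partial trace, which then acts on
  each term separately.\<close>

lemma bloch_form_entries:
  "bloch_form a b T $ (l, i) $ (k, j) = (1/4) *\<^sub>R
     (mat 1 $ l $ k * qubit_op 1 b $ i $ j
      + (\<Sum>q\<in>UNIV. pauli q $ l $ k * qubit_op (a $ q) (T $ q) $ i $ j))"
proof -
  have "pauli q $ l $ k * qubit_op (a $ q) (T $ q) $ i $ j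
    = (a $ q) *\<^sub>R pauli q $ l $ k * mat 1 $ i $ j
      + (\<Sum>p\<in>UNIV. (T $ q $ p) *\<^sub>R (pauli q $ l $ k * pauli p $ i $ j))" for q
    by (simp add: qubit_op_def pauli_dot_def sum_distrib_left distrib_left del: pauli_simps)
  then show ?thesis
    by (simp add: bloch_form_def kron_def qubit_op_def pauli_dot_def sum.distrib sum_distrib_left
        sum_distrib_right distrib_left add_ac del: pauli_simps)
qed

text \<open>Pauli matrices are traceless and pairwise orthogonal for the trace, so \<open>c\<close>
  picks out only \<open>qubit_op 1 b\<close> and \<open>w $ q\<close> only the operator paired with
  \<open>pauli q\<close>. The factor 1/2 is the normalisation 1/4 times the trace 2 of a squared
  Pauli matrix.\<close>

lemma ptrace_A_steer:
  "ptrace_A (kron (qubit_op c w) (mat 1) ** bloch_form a b T)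
     = qubit_op ((c + a \<bullet> w) / 2) ((1/2) *\<^sub>R (c *\<^sub>R b + transpose T *v w))"
proof -
  let ?P = "ptrace_A (kron (qubit_op c w) (mat 1) ** bloch_form a b T)"
  have mat: "(mat 1 :: complex^2^2) $ 1 $ 1 = 1" "(mat 1 :: complex^2^2) $ 1 $ 2 = 0"
    "(mat 1 :: complex^2^2) $ 2 $ 1 = 0" "(mat 1 :: complex^2^2) $ 2 $ 2 = 1"
    by (simp_all add: mat_def)
  note simps = sum_2 sum_3 qubit_op_entries mat complex_eq_iff inner_vec_def transpose_def
    matrix_vector_mult_def
  have "?P $ 1 $ 1 = Complex ((c + a \<bullet> w) / 2 + (c *\<^sub>R b + transpose T *v w) $ 3 / 2) 0"
    unfolding ptrace_A_kron_mat_1 bloch_form_entries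
    by (simp add: simps) (simp add: algebra_simps add_divide_distrib diff_divide_distrib)
  moreover have "?P $ 1 $ 2 = Complex ((c *\<^sub>R b + transpose T *v w) $ 1 / 2) (- (c *\<^sub>R b + transpose T *v w) $ 2 / 2)"
    unfolding ptrace_A_kron_mat_1 bloch_form_entries
    by (simp add: simps) (simp add: algebra_simps add_divide_distrib diff_divide_distrib)
  moreover have "?P $ 2 $ 1 = Complex ((c *\<^sub>R b + transpose T *v w) $ 1 / 2) ((c *\<^sub>R b + transpose T *v w) $ 2 / 2)"
    unfolding ptrace_A_kron_mat_1 bloch_form_entries
    by (simp add: simps) (simp add: algebra_simps add_divide_distrib diff_divide_distrib)
  moreover have "?P $ 2 $ 2 = Complex ((c + a \<bullet> w) / 2 - (c *\<^sub>R b + transpose T *v w) $ 3 / 2) 0"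
    unfolding ptrace_A_kron_mat_1 bloch_form_entries
    by (simp add: simps) (simp add: algebra_simps add_divide_distrib diff_divide_distrib)
  ultimately show ?thesis
    by (simp add: vec_eq_iff forall_2 qubit_op_entries complex_eq_iff algebra_simps
        add_divide_distrib diff_divide_distrib)
qed

lemma outcome_prob_bloch_form:
  "outcome_prob (qubit_op c w) (bloch_form a b T) = c + a \<bullet> w"
proof -
  have "trace X = trace (ptrace_A X)" for X
    by (simp add: trace_def ptrace_A_def sum_UNIV_prod sum_2)
  then show ?thesis
    unfolding outcome_prob_def ptrace_A_steer
    by (simp add: trace_def sum_2 qubit_op_entries ptrace_A_steer)
qed

lemma steered_state_bloch_form:
  assumes "c + a \<bullet> w > 0"
  shows "steered_state (qubit_op c w) (bloch_form a b T)
    = qubit_op (1/2) ((1 / (2 * (c + a \<bullet> w))) *\<^sub>R (c *\<^sub>R b + transpose T *v w))"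
  using assms
  by (simp add: steered_state_def outcome_prob_bloch_form ptrace_A_steer scaleR_qubit_op mult.commute)

lemma ket_bra_eq_qubit_op: "ket_bra u = qubit_op ((norm u)\<^sup>2 / 2) ((1/2) *\<^sub>R bloch u)"
  by (simp add: vec_eq_iff forall_2 ket_bra_def qubit_op_entries bloch_def norm_vec_2_power2
      complex_eq_iff cmod_power2) (simp add: power2_eq_square field_simps)

text \<open>An effect proportional to the projector along \<open>m\<close> leaves Bob with a
  positive operator, and the inequality is the positivity criterion for it. The scale
  \<open>N\<close> cancels.\<close>

lemma norm_steered_le:
  assumes "pos_semidef (bloch_form a b T)" and m: "norm m = 1"
  shows "norm (b + transpose T *v m) \<le> 1 + a \<bullet> m"
proof -
  let ?X = "bloch_form a b T"
  obtain u where u: "norm u > 0" "bloch u = (norm u)\<^sup>2 *\<^sub>R m"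
    using bloch_surj_sphere[OF m] .
  define N where "N = (norm u)\<^sup>2"
  have N: "N > 0" "bloch u = N *\<^sub>R m" using u by (simp_all add: N_def)
  define P where "P = ptrace_A (kron (ket_bra u) (mat 1) ** ?X)"
  have P: "P = qubit_op (N * (1 + a \<bullet> m) / 4) ((N / 4) *\<^sub>R (b + transpose T *v m))"
    by (simp add: P_def ket_bra_eq_qubit_op ptrace_A_steer N flip: N_def)
      (simp add: algebra_simps matrix_vector_mult_scaleR add_divide_distrib flip: transpose_matrix_vector)
  have "0 \<le> Re (cdot v (P *v v))" for v
  proof -
    \<comment> \<open>Testing the joint state on product vectors evaluates the form of Bob's
      operator \<open>P\<close> at \<open>v\<close>.\<close>
    let ?uv = "(\<chi> p. u $ fst p * v $ snd p) :: complex^(2 \<times> 2)"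
    have "cdot ?uv (?X *v ?uv) = cdot v (P *v v)"
      by (simp add: P_def cdot_def matrix_vector_mult_def sum_UNIV_prod ptrace_A_kron_mat_1 sum_2
          ket_bra_def algebra_simps)
    moreover have "0 \<le> Re (cdot ?uv (?X *v ?uv))"
      using assms(1) unfolding pos_semidef_def by blast
    ultimately show ?thesis by simp
  qed
  then have "pos_semidef P"
    unfolding P by (simp add: pos_semidef_def hermitian_qubit_op)
  then have "N / 4 * norm (b + transpose T *v m) \<le> N / 4 * (1 + a \<bullet> m)"
    unfolding P pos_semidef_qubit_op using N by simp
  then show ?thesis
    using N by simp
qed

section \<open>Nonclassicality in terms of the Bloch vector\<close>

lemma eigenbasis_pauli_dot_bloch:
  assumes n: "norm n = 1" and e: "eigenbasis (pauli_dot n) e"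
  shows "(bloch (e 1) = n \<and> bloch (e 2) = - n) \<or> (bloch (e 1) = - n \<and> bloch (e 2) = n)"
proof -
  have o: "orthonormal_basis e" using e by (simp add: eigenbasis_def)
  have q: "pauli_dot n = qubit_op 0 n" by (simp add: qubit_op_def)
  have *: "bloch (e i) = n \<or> bloch (e i) = - n" for i
  proof -
    have ee: "cdot (e i) (e i) = 1" using o by (simp add: orthonormal_basis_def)
    then have ne: "(norm (e i))\<^sup>2 = 1" using cdot_self[of "e i"] by (metis of_real_1 of_real_eq_iff)
    obtain l where l: "pauli_dot n *v e i = l *s e i"
      using e unfolding eigenbasis_def by blast
    \<comment> \<open>The eigenvalue is an expectation value, hence real, and has modulus
      \<open>norm n\<close>. Equality in Cauchy-Schwarz then leaves only
      \<open>\<plusminus> n\<close>.\<close>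
    have "l = of_real (n \<bullet> bloch (e i))"
      using cdot_qubit_op[of "e i" 0 n] ee by (simp add: l cdot_scale_right flip: q)
    moreover have "(cmod l)\<^sup>2 = 1"
    proof -
      have "(norm (l *s e i))\<^sup>2 = (cmod l)\<^sup>2 * (norm (e i))\<^sup>2"
        unfolding norm_vec_2_power2 cmod_power2
        by simp (simp add: power2_eq_square algebra_simps)
      then show ?thesis
        using norm_qubit_op_mult[of 0 n "e i"] n ne by (simp add: l flip: q)
    qed
    ultimately have "(n \<bullet> bloch (e i))\<^sup>2 = 1" by simp
    then have s: "n \<bullet> bloch (e i) = 1 \<or> n \<bullet> bloch (e i) = - 1"
      by (simp add: power2_eq_1_iff)
    have "bloch (e i) \<bullet> bloch (e i) = 1" "n \<bullet> n = 1"
      using n ne by (simp_all add: norm_bloch flip: power2_norm_eq_inner)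
    then have "(bloch (e i) - n) \<bullet> (bloch (e i) - n) = 0 \<or> (bloch (e i) + n) \<bullet> (bloch (e i) + n) = 0"
      using s by (auto simp: inner_diff inner_add inner_commute)
    then show ?thesis
      by (auto simp: eq_neg_iff_add_eq_0)
  qed
  \<comment> \<open>Completeness makes the two Bloch vectors cancel, so the signs differ. Their
    order stays open, since an eigenbasis may list its vectors either way.\<close>
  have "ket_bra (e 1) + ket_bra (e 2) = mat 1"
    using orthonormal_basis_complete[OF o] by (simp add: sum_2)
  then have "\<forall>i j. (ket_bra (e 1) + ket_bra (e 2)) $ i $ j = (mat 1 :: complex^2^2) $ i $ j"
    by simp
  then have "bloch (e 1) + bloch (e 2) = 0"
    by (simp add: forall_2 vec_eq_iff forall_3 bloch_def ket_bra_def mat_def complex_eq_iff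
        cmod_power2 algebra_simps) (simp add: power2_eq_square algebra_simps)
  moreover have "n \<noteq> 0" using n by auto
  then have "n + n \<noteq> 0" by (metis scaleR_2 scaleR_eq_0_iff zero_neq_numeral)
  moreover have "- n + - n \<noteq> 0" using \<open>n + n \<noteq> 0\<close> by (metis add.inverse_distrib_swap neg_equal_0_iff_equal)
  ultimately show ?thesis
    using *[of 1] *[of 2] by auto
qed

text \<open>The sum is symmetric under exchanging \<open>n\<close> and \<open>- n\<close>, so the
  undetermined order of the eigenvectors does no harm.\<close>

lemma N_KD_qubit_op:
  assumes n: "norm n = 1" and e: "eigenbasis (pauli_dot n) e"
  shows "N_KD e (qubit_op (1/2) ((1/2) *\<^sub>R r)) = (norm (r + n) + norm (r - n)) / 4 - 1/2"
proof -
  have o: "orthonormal_basis e" using e by (simp add: eigenbasis_def)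
  have norm_eq: "norm (qubit_op (1/2) ((1/2) *\<^sub>R r) *v e i) = norm (r + bloch (e i)) / 2" for i
  proof -
    have "cdot (e i) (e i) = 1" using o by (simp add: orthonormal_basis_def)
    then have ne: "(norm (e i))\<^sup>2 = 1" using cdot_self[of "e i"] by (metis of_real_1 of_real_eq_iff)
    have "(norm (qubit_op (1/2) ((1/2) *\<^sub>R r) *v e i))\<^sup>2 = (norm (r + bloch (e i)) / 2)\<^sup>2"
      using norm_bloch[of "e i"]
      by (simp add: norm_qubit_op_mult ne power_divide)
        (simp add: power2_norm_eq_inner inner_add inner_commute norm_eq_1 ne power_divide field_simps)
    then show ?thesis
      by (subst (asm) power2_eq_iff_nonneg) auto
  qed
  show ?thesis
    using eigenbasis_pauli_dot_bloch[OF assms]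
    unfolding N_KD_eq[OF o hermitian_qubit_op] norm_eq by (auto simp: sum_2 field_simps)
qed

text \<open>Pythagoras: the component of \<open>r + s *\<^sub>R n\<close> along \<open>n\<close> is
  \<open>s * (1 + s * (r \<bullet> n))\<close>, and its orthogonal part is that of
  \<open>r\<close>.\<close>

lemma sqrt_parallel_perp:
  fixes r n :: "real^3"
  assumes "norm n = 1" and "s = 1 \<or> s = - 1"
  shows "sqrt ((1 + s * (r \<bullet> n))\<^sup>2 + (norm (cross3 r n))\<^sup>2) = norm (r + s *\<^sub>R n)"
proof -
  have "(norm (cross3 r n))\<^sup>2 = (norm r)\<^sup>2 - (r \<bullet> n)\<^sup>2"
    using norm_cross_dot[of r n] assms by simp
  moreover have "(norm (r + s *\<^sub>R n))\<^sup>2 = (norm r)\<^sup>2 + 2 * s * (r \<bullet> n) + 1"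
    using assms by (auto simp: power2_norm_eq_inner inner_add inner_diff inner_commute norm_eq_1)
  ultimately have "(1 + s * (r \<bullet> n))\<^sup>2 + (norm (cross3 r n))\<^sup>2 = (norm (r + s *\<^sub>R n))\<^sup>2"
    using assms(2) by (auto simp: power2_eq_square algebra_simps)
  then show ?thesis by simp
qed

subsection \<open>Attainment\<close>

text \<open>If \<open>norm a = 1\<close>, the bound decays quadratically as \<open>m\<close> approaches \<open>- a\<close>, which forces
  the linear part of \<open>b + L m\<close> to vanish orthogonally to \<open>a\<close>: the state is a product.\<close>

lemma affine_bound_pure:
  fixes a b :: "'a::euclidean_space" and L :: "'a \<Rightarrow> 'a"
  assumes L: "linear L" and le: "\<And>m. norm m = 1 \<Longrightarrow> norm (b + L m) \<le> 1 + a \<bullet> m"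
    and a: "norm a = 1"
  shows "b + L m = (1 + a \<bullet> m) *\<^sub>R b"
proof -
  interpret linear L by fact
  have aa: "a \<bullet> a = 1" using a by (simp add: norm_eq_1)
  \<comment> \<open>At \<open>m = - a\<close> the bound is zero.\<close>
  have b: "b = L a"
    using le[of "- a"] a by (simp add: aa neg)
  define u where "u = m - (a \<bullet> m) *\<^sub>R a"
  have au: "a \<bullet> u = 0" "u \<bullet> a = 0"
    by (simp_all add: u_def inner_diff aa inner_commute)
  have bound: "norm (t *\<^sub>R (u \<bullet> u) *\<^sub>R L a + L u) \<le> t * (u \<bullet> u)" if t: "t > 0" for t :: real
  proof -
    \<comment> \<open>The point \<open>v\<close> stays on the unit sphere and tends to
      \<open>- a\<close> as \<open>t\<close> tends to zero. There
      \<open>1 + a \<bullet> v = 2 * q / (1 + q)\<close> is quadratic in \<open>t\<close>, while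
      \<open>b + L v\<close> has the first-order coefficient \<open>2 *\<^sub>R L u\<close>.\<close>
    define q where "q = t\<^sup>2 * (u \<bullet> u)"
    have q: "q \<ge> 0" by (simp add: q_def)
    define v where "v = (1 / (1 + q)) *\<^sub>R ((2 * t) *\<^sub>R u - (1 - q) *\<^sub>R a)"
    have "((2 * t) *\<^sub>R u - (1 - q) *\<^sub>R a) \<bullet> ((2 * t) *\<^sub>R u - (1 - q) *\<^sub>R a) = 4 * q + (1 - q)\<^sup>2"
      by (simp add: inner_diff au aa) (simp add: q_def power2_eq_square algebra_simps)
    also have "\<dots> = (1 + q)\<^sup>2" by (simp add: power2_eq_square algebra_simps)
    finally have "norm ((2 * t) *\<^sub>R u - (1 - q) *\<^sub>R a) = 1 + q"
      using q by (simp add: norm_eq_sqrt_inner)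
    then have "norm v = 1" using q by (simp add: v_def)
    have "(1 + q) *\<^sub>R (b + L v) = (2 * t) *\<^sub>R (t *\<^sub>R (u \<bullet> u) *\<^sub>R L a + L u)"
      using q by (simp add: v_def scale diff b scaleR_add_right)
        (simp add: algebra_simps q_def power2_eq_square flip: scaleR_2)
    moreover have "(1 + q) * (1 + a \<bullet> v) = (2 * t) * (t * (u \<bullet> u))"
      using q by (simp add: v_def inner_diff au aa) (simp add: q_def power2_eq_square field_simps)
    moreover have "(1 + q) * norm (b + L v) \<le> (1 + q) * (1 + a \<bullet> v)"
      using q le[OF \<open>norm v = 1\<close>] by (intro mult_left_mono) auto
    then have "norm ((1 + q) *\<^sub>R (b + L v)) \<le> (1 + q) * (1 + a \<bullet> v)"
      using q by simp
    ultimately have "norm ((2 * t) *\<^sub>R (t *\<^sub>R (u \<bullet> u) *\<^sub>R L a + L u)) \<le> (2 * t) * (t * (u \<bullet> u))"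
      by simp
    then show ?thesis using t by simp
  qed
  \<comment> \<open>The limit of \<open>bound\<close> as \<open>t\<close> decreases to zero gives
    \<open>L u = 0\<close>.\<close>
  have "((\<lambda>t. norm (t *\<^sub>R (u \<bullet> u) *\<^sub>R L a + L u)) \<longlongrightarrow> norm (0 *\<^sub>R (u \<bullet> u) *\<^sub>R L a + L u)) (at_right (0::real))"
    by (intro tendsto_intros)
  moreover have "((\<lambda>t. t * (u \<bullet> u)) \<longlongrightarrow> 0 * (u \<bullet> u)) (at_right (0::real))"
    by (intro tendsto_intros)
  moreover have "\<forall>\<^sub>F t in at_right (0::real). norm (t *\<^sub>R (u \<bullet> u) *\<^sub>R L a + L u) \<le> t * (u \<bullet> u)"
    using bound by (auto simp: eventually_at_filter)
  ultimately have "norm (0 *\<^sub>R (u \<bullet> u) *\<^sub>R L a + L u) \<le> 0 * (u \<bullet> u)"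
    by (intro tendsto_le[of "at_right (0::real)"]) auto
  then have "L m = (a \<bullet> m) *\<^sub>R b"
    by (simp add: u_def diff scale b)
  then show ?thesis by (simp add: scaleR_add_left)
qed

text \<open>The admissible directions fill the compact sphere only if \<open>norm a < 1\<close>.
  Otherwise the bound opposite to \<open>a\<close> forces \<open>norm a = 1\<close>, and the steered
  vector is constant on all admissible directions.\<close>

lemma steered_attains_max:
  fixes a b :: "'a::euclidean_space" and L :: "'a \<Rightarrow> 'a" and g :: "'a \<Rightarrow> real"
  assumes L: "linear L" and le: "\<And>m. norm m = 1 \<Longrightarrow> norm (b + L m) \<le> 1 + a \<bullet> m"
    and g: "continuous_on UNIV g"
  shows "\<exists>m. norm m = 1 \<and> 1 + a \<bullet> m > 0 \<and>
    (\<forall>m'. norm m' = 1 \<and> 1 + a \<bullet> m' > 0 \<longrightarrow>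
      g ((1 / (1 + a \<bullet> m')) *\<^sub>R (b + L m')) \<le> g ((1 / (1 + a \<bullet> m)) *\<^sub>R (b + L m)))"
proof (cases "norm a < 1")
  case True
  have pos: "1 + a \<bullet> m > 0" if "norm m = 1" for m
    using Cauchy_Schwarz_ineq2[of a m] that True by simp
  have contL: "continuous_on S L" for S
    using L by (simp add: linear_continuous_on linear_conv_bounded_linear)
  have cont: "continuous_on (sphere 0 1) (\<lambda>m. g ((1 / (1 + a \<bullet> m)) *\<^sub>R (b + L m)))"
    by (intro continuous_on_compose2[OF g] continuous_intros contL) (use pos in force)+
  obtain m where "m \<in> sphere 0 1" "\<And>m'. m' \<in> sphere 0 1 \<Longrightarrow>
      g ((1 / (1 + a \<bullet> m')) *\<^sub>R (b + L m')) \<le> g ((1 / (1 + a \<bullet> m)) *\<^sub>R (b + L m))"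
    using continuous_attains_sup[OF compact_sphere _ cont] by auto
  then show ?thesis using pos by auto
next
  case False
  then have a0: "a \<noteq> 0" by auto
  have "0 \<le> 1 + a \<bullet> (- (1 / norm a) *\<^sub>R a)"
    by (rule order_trans[OF norm_ge_zero le]) (simp add: a0)
  also have "a \<bullet> (- (1 / norm a) *\<^sub>R a) = - norm a"
    using a0 by (simp add: power2_norm_eq_inner[symmetric] power2_eq_square)
  finally have a: "norm a = 1" using False by simp
  have "(1 / (1 + a \<bullet> m)) *\<^sub>R (b + L m) = b" if "1 + a \<bullet> m > 0" for m
  proof -
    have "b + L m = (1 + a \<bullet> m) *\<^sub>R b"
      by (rule affine_bound_pure[OF L le a])
    then show ?thesis using that by simp
  qed
  moreover have "1 + a \<bullet> a > 0" by (rule add_pos_nonneg) auto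
  ultimately show ?thesis using a by (intro exI[of _ a]) auto
qed

section \<open>Reduction to projective measurements and the two maxima\<close>

theorem theorem5:
  fixes \<rho> :: "complex^(2 \<times> 2)^(2 \<times> 2)"
    and a b n :: "real^3" and T :: "real^3^3"
    and e :: "2 \<Rightarrow> complex^2"
  assumes "density_operator \<rho>"
    and "\<rho> = bloch_form a b T"
    and "b \<noteq> 0"
    and "n = (1 / norm b) *\<^sub>R b"
    and "eigenbasis (pauli_dot n) e"
  shows "is_maximum (steered_KD_values e \<rho>) (R_KD e \<rho>) \<and>
    is_maximum
      {MAX s\<in>{s \<in> {1, - 1}. 1 + a \<bullet> (s *\<^sub>R m) > 0}.
          (1/4) * (sqrt ((1 + s * r_par a b T n (s *\<^sub>R m))\<^sup>2 + (r_perp a b T n (s *\<^sub>R m))\<^sup>2)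
                 + sqrt ((1 - s * r_par a b T n (s *\<^sub>R m))\<^sup>2 + (r_perp a b T n (s *\<^sub>R m))\<^sup>2))
          - 1/2 | m. norm m = 1}
      (R_KD e \<rho>)"
proof -
  have n: "norm n = 1" using assms(3,4) by simp
  let ?L = "\<lambda>m. transpose T *v m"
  have lin: "linear ?L" by (rule matrix_vector_mul_linear)
  have le: "norm (b + ?L m) \<le> 1 + a \<bullet> m" if "norm m = 1" for m
    using norm_steered_le[of a b T m] that assms(1,2) by (simp add: density_operator_def)
  define g where "g r = (norm (r + n) + norm (r - n)) / 4 - 1/2" for r
  have "continuous_on UNIV g"
    unfolding g_def by (intro continuous_intros) auto
  from steered_attains_max[OF lin le this, folded steered_bloch_def]
  obtain m0 where m0: "norm m0 = 1" "1 + a \<bullet> m0 > 0"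
    and max: "\<And>m. norm m = 1 \<Longrightarrow> 1 + a \<bullet> m > 0 \<Longrightarrow> g (steered_bloch a b T m) \<le> g (steered_bloch a b T m0)"
    by blast
  define K where "K = g (steered_bloch a b T m0)"
  text \<open>\<open>H\<close> is the perspective of \<open>4 * g + 2\<close>. Being sublinear, it expresses the convexity of \<open>g\<close>
    without dividing by outcome probabilities, which may vanish.\<close>
  define H where "H v p = norm (v + p *\<^sub>R n) + norm (v - p *\<^sub>R n)" for v and p :: real
  have H_scale: "H (t *\<^sub>R v) (t * p) = t * H v p" if "t \<ge> 0" for t v p
  proof -
    have "t *\<^sub>R v + (t * p) *\<^sub>R n = t *\<^sub>R (v + p *\<^sub>R n)" "t *\<^sub>R v - (t * p) *\<^sub>R n = t *\<^sub>R (v - p *\<^sub>R n)"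
      by (simp_all add: algebra_simps)
    then show ?thesis
      unfolding H_def by (simp only: norm_scaleR abs_of_nonneg[OF that] distrib_left)
  qed
  have H_add: "H (v + w) (p + q) \<le> H v p + H w q" for v w p q
  proof -
    have "v + w + (p + q) *\<^sub>R n = (v + p *\<^sub>R n) + (w + q *\<^sub>R n)"
      "v + w - (p + q) *\<^sub>R n = (v - p *\<^sub>R n) + (w - q *\<^sub>R n)"
      by (simp_all add: algebra_simps)
    then show ?thesis
      unfolding H_def by (smt (verit) norm_triangle_ineq)
  qed
  have g_H: "p * (4 * g ((1 / p) *\<^sub>R v) + 2) = H v p" if "p > 0" for p v
    using H_scale[of p "(1 / p) *\<^sub>R v" 1] that by (simp add: g_def H_def)
  have H_le: "H (b + ?L m) (1 + a \<bullet> m) \<le> (4 * K + 2) * (1 + a \<bullet> m)" if m: "norm m = 1" for m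
  proof (cases "1 + a \<bullet> m > 0")
    case True
    then show ?thesis
      using max[OF m True] mult_left_mono[of "4 * g (steered_bloch a b T m) + 2" "4 * K + 2" "1 + a \<bullet> m"]
      by (simp add: K_def steered_bloch_def g_H[OF True, symmetric] mult.commute)
  next
    \<comment> \<open>In a direction of probability zero, \<open>le\<close> makes Bob's operator
      vanish, so both sides are zero.\<close>
    case False
    then have "1 + a \<bullet> m = 0" "norm (b + ?L m) = 0"
      using le[OF m] norm_ge_zero[of "b + ?L m"] by linarith+
    then show ?thesis by (simp add: H_def)
  qed
  have N_KD_steered: "N_KD e (steered_state (qubit_op c w) \<rho>)
      = g ((1 / (c + a \<bullet> w)) *\<^sub>R (c *\<^sub>R b + ?L w))" if "c + a \<bullet> w > 0" for c w
  proof -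
    have "(1 / (2 * (c + a \<bullet> w))) *\<^sub>R (c *\<^sub>R b + ?L w)
       = (1/2) *\<^sub>R ((1 / (c + a \<bullet> w)) *\<^sub>R (c *\<^sub>R b + ?L w))"
      by simp
    then show ?thesis
      unfolding assms(2) steered_state_bloch_form[OF that] g_def
      using N_KD_qubit_op[OF n assms(5)] by metis
  qed
  have 1: "is_maximum (steered_KD_values e \<rho>) K"
    unfolding is_maximum_def
  proof (intro conjI ballI)
    \<comment> \<open>Outcome \<open>0\<close> of the projective measurement along \<open>m0\<close>
      attains \<open>K\<close>.\<close>
    define M where "M x = qubit_op (1/2) ((if x = 0 then 1/2 else -1/2) *\<^sub>R m0)" for x :: nat
    have M0: "M 0 = qubit_op (1/2) ((1/2) *\<^sub>R m0)" by (simp add: M_def)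
    have "povm {0, 1} M"
      using m0(1)
      by (simp add: povm_def M_def pos_semidef_qubit_op vec_eq_iff forall_2 qubit_op_entries mat_def
          complex_eq_iff)
    moreover have "outcome_prob (M 0) \<rho> > 0"
      using m0 by (simp add: M0 assms(2) outcome_prob_bloch_form)
    moreover have "N_KD e (steered_state (M 0) \<rho>) = K"
    proof -
      have "(1 / (1/2 + a \<bullet> ((1/2) *\<^sub>R m0))) *\<^sub>R ((1/2) *\<^sub>R b + ?L ((1/2) *\<^sub>R m0)) = steered_bloch a b T m0"
      proof -
        have "1 / (1/2 + a \<bullet> ((1/2) *\<^sub>R m0)) = 2 / (1 + a \<bullet> m0)"
          using m0 by (simp add: field_simps)
        moreover have "(1/2) *\<^sub>R b + ?L ((1/2) *\<^sub>R m0) = (1/2) *\<^sub>R (b + ?L m0)"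
          by (simp only: matrix_vector_mult_scaleR scaleR_add_right)
        moreover have "2 / (1 + a \<bullet> m0) * (1/2) = 1 / (1 + a \<bullet> m0)"
          using m0 by (simp add: field_simps)
        ultimately show ?thesis by (simp only: steered_bloch_def scaleR_scaleR)
      qed
      then show ?thesis
        unfolding M0 K_def using m0 by (subst N_KD_steered) auto
    qed
    ultimately show "K \<in> steered_KD_values e \<rho>"
      unfolding steered_KD_values_def by blast
  next
    fix y assume "y \<in> steered_KD_values e \<rho>"
    then obtain I M x where M: "y = N_KD e (steered_state (M x) \<rho>)" "povm I M" "x \<in> I"
        "outcome_prob (M x) \<rho> > 0"
      unfolding steered_KD_values_def by blast
    then have psd: "pos_semidef (M x)" by (simp add: povm_def)
    then obtain c w where cw: "M x = qubit_op c w"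
      using hermitian_imp_qubit_op unfolding pos_semidef_def by blast
    have wc: "norm w \<le> c" using psd by (simp add: cw pos_semidef_qubit_op)
    define p where "p = c + a \<bullet> w"
    have p: "p > 0" using M(4) by (simp add: cw assms(2) outcome_prob_bloch_form p_def)
    obtain m where m: "norm m = 1" "w = norm w *\<^sub>R m"
    proof (cases "w = 0")
      case True
      then show ?thesis using that vector_choose_size[of 1] by auto
    next
      case False
      then show ?thesis using that[of "(1 / norm w) *\<^sub>R w"] by simp
    qed
    \<comment> \<open>These are half the eigenvalues \<open>c \<plusminus> norm w\<close> of the
      effect: it equals \<open>\<alpha>\<close> times \<open>qubit_op 1 m\<close> plus
      \<open>\<beta>\<close> times \<open>qubit_op 1 (- m)\<close>.\<close>
    define \<alpha> \<beta> where "\<alpha> = (c + norm w) / 2" and "\<beta> = (c - norm w) / 2"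
    have "c + norm w \<ge> 0" "c - norm w \<ge> 0" using wc norm_ge_zero[of w] by linarith+
    then have nn: "\<alpha> \<ge> 0" "\<beta> \<ge> 0" by (simp_all add: \<alpha>_def \<beta>_def)
    have ab: "\<alpha> + \<beta> = c" "\<alpha> - \<beta> = norm w" by (auto simp: \<alpha>_def \<beta>_def field_simps)
    have w: "w = (\<alpha> - \<beta>) *\<^sub>R m" using m by (simp add: ab)
    have Lm: "?L (- m) = - ?L m" "?L w = (\<alpha> - \<beta>) *\<^sub>R ?L m"
      using lin w by (simp_all only: linear_neg linear_scale)
    have v: "c *\<^sub>R b + ?L w = \<alpha> *\<^sub>R (b + ?L m) + \<beta> *\<^sub>R (b + ?L (- m))"
      unfolding Lm ab(1)[symmetric] by (simp add: algebra_simps del: transpose_matrix_vector)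
    have pp: "p = \<alpha> * (1 + a \<bullet> m) + \<beta> * (1 + a \<bullet> (- m))"
      unfolding p_def w ab(1)[symmetric] by (simp add: algebra_simps)
    \<comment> \<open>Sublinearity of \<open>H\<close> splits the effect into its two projective
      directions, and \<open>H_le\<close> covers each of them even at probability zero.\<close>
    have "p * (4 * y + 2) = H (c *\<^sub>R b + ?L w) p"
      using M(1) N_KD_steered[of c w] p g_H[OF p, of "c *\<^sub>R b + ?L w"] by (simp add: cw p_def)
    also have "\<dots> \<le> \<alpha> * H (b + ?L m) (1 + a \<bullet> m) + \<beta> * H (b + ?L (- m)) (1 + a \<bullet> (- m))"
      unfolding v pp by (rule order_trans[OF H_add]) (simp only: H_scale nn order_refl)
    also have "\<dots> \<le> \<alpha> * ((4 * K + 2) * (1 + a \<bullet> m)) + \<beta> * ((4 * K + 2) * (1 + a \<bullet> (- m)))"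
      using m(1) by (intro add_mono mult_left_mono nn H_le) auto
    also have "\<dots> = p * (4 * K + 2)"
      unfolding pp by algebra
    finally show "y \<le> K" using p by simp
  qed
  then have R: "R_KD e \<rho> = K"
    unfolding R_KD_def by (rule maximum_eq)
  \<comment> \<open>The second root is the case \<open>- s\<close> of
    \<open>sqrt_parallel_perp\<close>. Both signs are summed, so the value depends on
    \<open>v\<close> alone.\<close>
  have expr: "(1/4) * (sqrt ((1 + s * r_par a b T n v)\<^sup>2 + (r_perp a b T n v)\<^sup>2)
      + sqrt ((1 - s * r_par a b T n v)\<^sup>2 + (r_perp a b T n v)\<^sup>2)) - 1/2 = g (steered_bloch a b T v)"
    if "s \<in> {1, - 1}" for s v
  proof -
    have s: "s = 1 \<or> s = - 1" "- s = 1 \<or> - s = - 1" using that by auto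
    have "norm (r + s *\<^sub>R n) + norm (r + (- s) *\<^sub>R n) = norm (r + n) + norm (r - n)" for r
      using s(1) by auto
    then show ?thesis
      using sqrt_parallel_perp[OF n s(1), of "steered_bloch a b T v"]
        sqrt_parallel_perp[OF n s(2), of "steered_bloch a b T v"]
      by (simp add: r_par_def r_perp_def g_def)
  qed
  let ?S = "\<lambda>m. {s \<in> {1, - 1 :: real}. 1 + a \<bullet> (s *\<^sub>R m) > 0}"
  let ?F = "\<lambda>m. \<lambda>s. (1/4) * (sqrt ((1 + s * r_par a b T n (s *\<^sub>R m))\<^sup>2 + (r_perp a b T n (s *\<^sub>R m))\<^sup>2)
                 + sqrt ((1 - s * r_par a b T n (s *\<^sub>R m))\<^sup>2 + (r_perp a b T n (s *\<^sub>R m))\<^sup>2)) - 1/2"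
  have fin: "finite (?F m ` ?S m)" for m by simp
  have F_le: "x \<le> K" if m: "norm m = 1" and x: "x \<in> ?F m ` ?S m" for m x
  proof -
    obtain s where s: "s \<in> {1, - 1}" "1 + a \<bullet> (s *\<^sub>R m) > 0" "x = ?F m s"
      using x by blast
    have "norm (s *\<^sub>R m) = 1" using s(1) m by auto
    then show ?thesis
      unfolding s(3) expr[OF s(1)] K_def by (rule max) (rule s(2))
  qed
  have 2: "is_maximum {Max (?F m ` ?S m) | m. norm m = 1} K"
    unfolding is_maximum_def
  proof (intro conjI ballI)
    have "K = ?F m0 1" using expr[of 1 m0] by (simp add: K_def)
    then have "K \<in> ?F m0 ` ?S m0"
      using m0(2) by (intro image_eqI[of _ _ 1]) auto
    then have "Max (?F m0 ` ?S m0) = K"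
      using F_le[OF m0(1)] by (intro Max_eqI fin) auto
    then show "K \<in> {Max (?F m ` ?S m) | m. norm m = 1}"
      using m0(1) by blast
  next
    fix y assume "y \<in> {Max (?F m ` ?S m) | m. norm m = 1}"
    then obtain m where m: "norm m = 1" "y = Max (?F m ` ?S m)" by blast
    \<comment> \<open>Opposite directions cannot both have probability zero, so each inner maximum
      ranges over a nonempty set.\<close>
    have "1 + a \<bullet> m > 0 \<or> 1 - a \<bullet> m > 0" by linarith
    then have "?S m \<noteq> {}" by auto
    then have "y \<in> ?F m ` ?S m"
      unfolding m(2) by (intro Max_in fin) blast
    then show "y \<le> K" by (rule F_le[OF m(1)])
  qed
  show ?thesis
    unfolding R using 1 2 by blast
qed

end
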